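(* Let $n\ge 1$ be an integer and $0\le\alpha\le 1$. The generalised distance spectrum of the friendship graph $F_n$ (the multiset of eigenvalues of $D_\alpha(F_n)$, superscripts denoting multiplicities) is $$\operatorname{Spec}_{D_\alpha}(F_n)=\left\{((4n+1)\alpha-3)^{\,n-1},\ ((4n-1)\alpha-1)^{\,n},\ \lambda_+,\ \lambda_-\right\},$$ where $$\lambda_{\pm}=\frac{(2n+1)\alpha+4n-3\pm\sqrt{\left((2n+1)\alpha+4n-3\right)^2-8n(4n\alpha-\alpha-1)}}{2}.$$
   Context: For a connected graph $\Gamma$ with vertices $v_1,\dots,v_N$, the distance matrix is $D(\Gamma)=(d(v_i,v_j))_{i,j}$, where $d$ is the shortest-path distance; the transmission of $v_i$ is $Tr_i=\sum_{u\in V(\Gamma)}d(u,v_i)$ and $Tr(\Gamma)=\operatorname{diag}(Tr_1,\dots,Tr_N)$. The generalised distance matrix is $D_\alpha(\Gamma)=\alpha\,Tr(\Gamma)+(1-\alpha)D(\Gamma)$, $0\le\alpha\le1$. The friendship graph $F_n$ is $K_1\vee(nK_2)$: a single vertex joined to all vertices of $n$ disjoint copies of $K_2$ (so it has $2n+1$ vertices). *)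

theory Defs
  imports "Graph_Theory.Graph_Theory" "Jordan_Normal_Form.Char_Poly"
begin

text \<open>Graphs are symmetric, loop-free pair digraphs (locale \<^locale>\<open>pair_graph\<close>): an edge
  \<open>uv\<close> is the pair of arcs \<open>(u, v)\<close>, \<open>(v, u)\<close>.\<close>

definition complete_graph :: "'a set \<Rightarrow> 'a pair_pre_digraph" where
  "complete_graph V = \<lparr> pverts = V, parcs = {(u, v). u \<in> V \<and> v \<in> V \<and> u \<noteq> v} \<rparr>"

definition graph_copies :: "nat \<Rightarrow> 'a pair_pre_digraph \<Rightarrow> (nat \<times> 'a) pair_pre_digraph" where
  "graph_copies n G =
     \<lparr> pverts = {..<n} \<times> pverts G,
       parcs = {((i, u), (i, v)) | i u v. i < n \<and> (u, v) \<in> parcs G} \<rparr>"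

definition graph_join ::
  "'a pair_pre_digraph \<Rightarrow> 'b pair_pre_digraph \<Rightarrow> ('a + 'b) pair_pre_digraph" where
  "graph_join G H =
     \<lparr> pverts = pverts G <+> pverts H,
       parcs = {(Inl u, Inl v) | u v. (u, v) \<in> parcs G}
             \<union> {(Inr u, Inr v) | u v. (u, v) \<in> parcs H}
             \<union> {(Inl u, Inr v) | u v. u \<in> pverts G \<and> v \<in> pverts H}
             \<union> {(Inr v, Inl u) | u v. u \<in> pverts G \<and> v \<in> pverts H} \<rparr>"

definition friendship_graph :: "nat \<Rightarrow> (unit + nat \<times> bool) pair_pre_digraph" where
  "friendship_graph n =
     graph_join (complete_graph (UNIV :: unit set))
                (graph_copies n (complete_graph (UNIV :: bool set)))"

text \<open>The library's weighted distance with all weights 1 is the shortest-path distance.  It is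
  \<open>\<infinity>\<close> between different components, so the conversion to \<^typ>\<open>real\<close> is only meaningful for
  connected graphs.\<close>

definition graph_dist :: "'a pair_pre_digraph \<Rightarrow> 'a \<Rightarrow> 'a \<Rightarrow> real" where
  "graph_dist G u v = real_of_ereal (wf_digraph.\<mu> (with_proj G) (\<lambda>_. 1) u v)"

definition transmission :: "'a pair_pre_digraph \<Rightarrow> 'a \<Rightarrow> real" where
  "transmission G v = (\<Sum>u\<in>pverts G. graph_dist G u v)"

text \<open>The list \<open>vs\<close> below is the enumeration of the vertices that indexes the rows and columns.\<close>

definition distance_matrix :: "'a pair_pre_digraph \<Rightarrow> 'a list \<Rightarrow> real mat" where
  "distance_matrix G vs =
     mat (length vs) (length vs) (\<lambda>(i, j). graph_dist G (vs ! i) (vs ! j))"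

definition transmission_matrix :: "'a pair_pre_digraph \<Rightarrow> 'a list \<Rightarrow> real mat" where
  "transmission_matrix G vs = mat_diag (length vs) (\<lambda>i. transmission G (vs ! i))"

definition gen_distance_matrix :: "real \<Rightarrow> 'a pair_pre_digraph \<Rightarrow> 'a list \<Rightarrow> real mat" where
  "gen_distance_matrix \<alpha> G vs =
     \<alpha> \<cdot>\<^sub>m transmission_matrix G vs + (1 - \<alpha>) \<cdot>\<^sub>m distance_matrix G vs"

text \<open>Eigenvalues with algebraic multiplicity.  The generalised distance matrix is real symmetric,
  so none of its eigenvalues is missed by counting roots over \<^typ>\<open>real\<close>, and algebraic and
  geometric multiplicities agree.\<close>

definition eigenvalue_mset :: "'a :: field mat \<Rightarrow> 'a multiset" where
  "eigenvalue_mset A = proots (char_poly A)"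

definition gen_distance_spectrum ::
  "real \<Rightarrow> 'a pair_pre_digraph \<Rightarrow> 'a list \<Rightarrow> real multiset" where
  "gen_distance_spectrum \<alpha> G vs = eigenvalue_mset (gen_distance_matrix \<alpha> G vs)"

lemma pair_graph_friendship_graph: "pair_graph (friendship_graph n)"
proof -
  let ?H = "graph_copies n (complete_graph (UNIV :: bool set))"
  have fin: "finite (pverts (friendship_graph n))"
    by (auto simp: friendship_graph_def graph_join_def graph_copies_def complete_graph_def)
  have wf: "parcs (friendship_graph n) \<subseteq> pverts (friendship_graph n) \<times> pverts (friendship_graph n)"
    by (auto simp: friendship_graph_def graph_join_def graph_copies_def complete_graph_def)
  have fina: "finite (parcs (friendship_graph n))"
    using wf fin by (meson finite_SigmaI finite_subset)
  show ?thesis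
  proof
    show "symmetric (with_proj (friendship_graph n))"
      by (auto simp: symmetric_def sym_def friendship_graph_def graph_join_def graph_copies_def
          complete_graph_def)
    show "fst e \<noteq> snd e" if "e \<in> parcs (friendship_graph n)" for e
      using that by (auto simp: friendship_graph_def graph_join_def graph_copies_def
          complete_graph_def)
  qed (use wf fin fina in auto)
qed

lemma card_friendship_graph: "card (pverts (friendship_graph n)) = 2 * n + 1"
  by (simp add: friendship_graph_def graph_join_def graph_copies_def complete_graph_def card_Plus)

lemma connected_friendship_graph: "connected (with_proj (friendship_graph n))"
proof -
  interpret pair_graph "friendship_graph n" by (rule pair_graph_friendship_graph)
  let ?G = "with_proj (friendship_graph n)"
  have into: "v \<rightarrow>\<^sup>*\<^bsub>?G\<^esub> Inl ()" and outof: "Inl () \<rightarrow>\<^sup>*\<^bsub>?G\<^esub> v"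
    if "v \<in> pverts (friendship_graph n)" for v
  proof -
    have *: "v = Inl () \<or> (v, Inl ()) \<in> parcs (friendship_graph n) \<and>
             (Inl (), v) \<in> parcs (friendship_graph n)"
      using that by (auto simp: friendship_graph_def graph_join_def graph_copies_def
          complete_graph_def)
    show "v \<rightarrow>\<^sup>*\<^bsub>?G\<^esub> Inl ()" "Inl () \<rightarrow>\<^sup>*\<^bsub>?G\<^esub> v"
      using * that by (elim disjE; simp)+
  qed
  have "strongly_connected ?G"
  proof (rule strongly_connectedI)
    show "verts ?G \<noteq> {}" using card_friendship_graph[of n] by auto
    show "u \<rightarrow>\<^sup>*\<^bsub>?G\<^esub> v" if "u \<in> verts ?G" "v \<in> verts ?G" for u v
      using into[of u] outof[of v] that by (auto intro: reachable_trans)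
  qed
  then show ?thesis
    by (auto simp: connected_def strongly_connected_def intro: reachable_mk_symmetricI)
qed

end

theory Submission
  imports Defs
begin

text \<open>The spectrum is read off from an explicit eigenbasis. Call \<open>Inl ()\<close> the centre, the other \<open>2n\<close>
  vertices the rim, and let \<open>s = 1 - \<alpha>\<close>. All distances between distinct vertices are 1 or 2: the
  centre is adjacent to everything, and two rim vertices are at distance 1 if they form one of the
  \<open>n\<close> pairs and at distance 2 otherwise. Hence the centre has transmission \<open>2n\<close>, a rim vertex has
  transmission \<open>4n - 2\<close>, and the matrix commutes with swapping the two vertices of a pair and
  with permuting the pairs. These symmetries split the space into three invariant parts:

  \<^item> Functions that are opposite on the two vertices of each pair and vanish at the centre
    (dimension \<open>n\<close>): the eigenvalue is \<open>(4n - 2)\<alpha> - s = (4n - 1)\<alpha> - 1\<close>.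
  \<^item> Functions that are constant on each pair, vanish at the centre and have sum 0
    (dimension \<open>n - 1\<close>): the eigenvalue is \<open>(4n - 2)\<alpha> - 3s = (4n + 1)\<alpha> - 3\<close>.
  \<^item> Functions that are constant on the rim (dimension 2): on pairs (value at the centre, value on
    the rim) the matrix acts as the quotient matrix with rows \<open>(2n\<alpha>, 2ns)\<close> and
    \<open>(s, 4n - 3 + \<alpha>)\<close>. Its trace is \<open>(2n + 1)\<alpha> + 4n - 3\<close> and its determinant is
    \<open>2n (4n\<alpha> - \<alpha> - 1)\<close>, so its eigenvalues are \<open>\<lambda>\<^sub>+\<close> and \<open>\<lambda>\<^sub>-\<close>.

  The eigenvectors of the quotient matrix are taken to be \<open>(2ns, \<lambda> - 2n\<alpha>)\<close>. They are
  independent unless \<open>s = 0\<close>, and for \<open>s = 0\<close> the matrix is diagonal, so that case is immediate.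

  The order of the vertices that indexes the matrix is arbitrary. The basis vectors are therefore
  indexed by the vertices as well: then both the matrix and its eigenbasis are functions of two
  vertices, and \<open>gen_distance_spectrum_eigenbasis\<close> gives the spectrum as the image of the
  vertex set under an eigenvalue function, with no permutation of rows and columns. The
  eigenvector equations are \<open>friendship_eigenvector_eigen\<close>, and independence is
  \<open>friendship_eigenvector_indep\<close>.\<close>

section \<open>Distances in the friendship graph\<close>

lemma (in pair_wf_digraph) graph_dist_INF:
  "graph_dist G u v = real_of_ereal (INF p\<in>{p. awalk u p v}. ereal (length p))"
  by (simp add: graph_dist_def \<mu>_def awalk_cost_def sum_list_triv)

text \<open>A shortest walk attains the infimum over all walks, so that exhibiting one computes the distance.\<close>

lemma (in pair_wf_digraph) graph_dist_eqI:
  assumes "awalk u p v" and "\<And>q. awalk u q v \<Longrightarrow> length p \<le> length q"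
  shows "graph_dist G u v = length p"
proof -
  have "(INF q\<in>{q. awalk u q v}. ereal (length q)) = ereal (length p)"
    by (rule antisym) (use assms in \<open>auto intro: INF_lower INF_greatest\<close>)
  then show ?thesis
    by (simp add: graph_dist_INF)
qed

lemma (in pair_wf_digraph) graph_dist_refl:
  assumes "u \<in> pverts G"
  shows "graph_dist G u u = 0"
  using graph_dist_eqI[of u "[]" u] assms by (simp add: awalk_Nil_iff)

lemma (in pair_wf_digraph) graph_dist_arc:
  assumes "(u, v) \<in> parcs G" and "u \<noteq> v"
  shows "graph_dist G u v = 1"
proof -
  have "graph_dist G u v = length [(u, v)]"
  proof (rule graph_dist_eqI)
    show "awalk u [(u, v)] v"
      using assms in_arcsD2 by (auto simp: awalk_Cons_iff awalk_Nil_iff)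
    show "length [(u, v)] \<le> length q" if "awalk u q v" for q
      using that assms(2) by (cases q) (auto simp: awalk_Nil_iff)
  qed
  then show ?thesis
    by simp
qed

lemma (in pair_wf_digraph) graph_dist_common_neighbour:
  assumes "(u, w) \<in> parcs G" and "(w, v) \<in> parcs G" and "u \<noteq> v" and "(u, v) \<notin> parcs G"
  shows "graph_dist G u v = 2"
proof -
  have "graph_dist G u v = length [(u, w), (w, v)]"
  proof (rule graph_dist_eqI)
    show "awalk u [(u, w), (w, v)] v"
      using assms in_arcsD2 by (auto simp: awalk_Cons_iff awalk_Nil_iff)
    show "length [(u, w), (w, v)] \<le> length q" if q: "awalk u q v" for q
    proof (cases q rule: remdups_adj.cases)
      case 1
      then show ?thesis using q assms(3) by (auto simp: awalk_Nil_iff)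
    next
      case (2 e)
      then show ?thesis using q assms(4) by (cases e) (auto simp: awalk_Cons_iff awalk_Nil_iff)
    qed simp
  qed
  then show ?thesis
    by simp
qed

lemma pverts_friendship_graph:
  "pverts (friendship_graph n) = insert (Inl ()) (Inr ` ({..<n} \<times> UNIV))"
  by (auto simp: friendship_graph_def graph_join_def graph_copies_def complete_graph_def UNIV_unit)

lemma parcs_friendship_graph [simp]:
  "(Inl x, Inl y) \<notin> parcs (friendship_graph n)"
  "(Inl x, Inr (j, b)) \<in> parcs (friendship_graph n) \<longleftrightarrow> j < n"
  "(Inr (i, a), Inl y) \<in> parcs (friendship_graph n) \<longleftrightarrow> i < n"
  "(Inr (i, a), Inr (j, b)) \<in> parcs (friendship_graph n) \<longleftrightarrow> i < n \<and> i = j \<and> a \<noteq> b"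
  by (auto simp: friendship_graph_def graph_join_def graph_copies_def complete_graph_def)

lemma graph_dist_friendship_graph:
  "graph_dist (friendship_graph n) (Inl ()) (Inl ()) = 0"
  "i < n \<Longrightarrow> graph_dist (friendship_graph n) (Inl ()) (Inr (i, a)) = 1"
  "i < n \<Longrightarrow> graph_dist (friendship_graph n) (Inr (i, a)) (Inl ()) = 1"
  "i < n \<Longrightarrow> j < n \<Longrightarrow> graph_dist (friendship_graph n) (Inr (i, a)) (Inr (j, b)) =
     2 - of_bool (i = j) - of_bool (i = j \<and> a = b)"
proof -
  interpret pair_graph "friendship_graph n"
    by (rule pair_graph_friendship_graph)
  show "graph_dist (friendship_graph n) (Inl ()) (Inl ()) = 0"
    by (rule graph_dist_refl) (simp add: pverts_friendship_graph)
  show "graph_dist (friendship_graph n) (Inl ()) (Inr (i, a)) = 1" if "i < n"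
    by (rule graph_dist_arc) (simp_all add: that)
  show "graph_dist (friendship_graph n) (Inr (i, a)) (Inl ()) = 1" if "i < n"
    by (rule graph_dist_arc) (simp_all add: that)
  show "graph_dist (friendship_graph n) (Inr (i, a)) (Inr (j, b)) =
     2 - of_bool (i = j) - of_bool (i = j \<and> a = b)" if "i < n" "j < n"
  proof -
    consider "i = j" "a = b" | "i = j" "a \<noteq> b" | "i \<noteq> j"
      by blast
    then show ?thesis
    proof cases
      case 1
      then show ?thesis
        using that by (simp add: graph_dist_refl pverts_friendship_graph)
    next
      case 2
      then show ?thesis
        using that by (simp add: graph_dist_arc)
    next
      case 3
      then show ?thesis
        using that by (simp add: graph_dist_common_neighbour[of _ "Inl ()"])
    qed
  qed
qed

section \<open>The distance matrix as an operator on functions of the vertices\<close>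

lemma sum_friendship_graph:
  fixes F :: "unit + nat \<times> bool \<Rightarrow> 'b::comm_monoid_add"
  shows "(\<Sum>u\<in>pverts (friendship_graph n). F u) =
    F (Inl ()) + (\<Sum>i<n. F (Inr (i, True)) + F (Inr (i, False)))"
proof -
  have "(\<Sum>u\<in>Inr ` ({..<n} \<times> UNIV). F u) = (\<Sum>i<n. \<Sum>b\<in>UNIV. F (Inr (i, b)))"
    by (simp add: sum.reindex sum.cartesian_product)
  then show ?thesis
    by (subst pverts_friendship_graph, subst sum.insert) (auto simp: UNIV_bool add.commute)
qed

lemma distance_operator_centre:
  "(\<Sum>u\<in>pverts (friendship_graph n). graph_dist (friendship_graph n) (Inl ()) u * F u) =
     (\<Sum>i<n. F (Inr (i, True)) + F (Inr (i, False)))"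
  by (simp add: sum_friendship_graph graph_dist_friendship_graph)

text \<open>On the rim, the distance matrix is \<open>2J\<close> minus corrections, where \<open>J\<close> is the all-ones matrix:
  the distance is 2, reduced by 1 within a pair and by 1 more on the diagonal. Applying
  it to a function \<open>F\<close> thus needs only the total of \<open>F\<close> over the rim, its total over a pair, and
  its value at the vertex. For eigenvectors these are easy to find.\<close>

lemma distance_operator_rim:
  assumes "i < n"
  shows "(\<Sum>u\<in>pverts (friendship_graph n). graph_dist (friendship_graph n) (Inr (i, b)) u * F u) =
     F (Inl ()) + 2 * (\<Sum>j<n. F (Inr (j, True)) + F (Inr (j, False)))
     - (F (Inr (i, True)) + F (Inr (i, False))) - F (Inr (i, b))"
proof -
  let ?d = "graph_dist (friendship_graph n)"
  have "?d (Inr (i, b)) (Inr (j, True)) * F (Inr (j, True))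
      + ?d (Inr (i, b)) (Inr (j, False)) * F (Inr (j, False))
      = 2 * (F (Inr (j, True)) + F (Inr (j, False)))
        - (if i = j then F (Inr (i, True)) + F (Inr (i, False)) + F (Inr (i, b)) else 0)"
    if "j < n" for j
    using assms that by (cases b) (auto simp: graph_dist_friendship_graph algebra_simps)
  then show ?thesis
    using assms
    by (simp add: sum_friendship_graph graph_dist_friendship_graph sum_subtractf
        sum.distrib sum_distrib_left)
qed

text \<open>By symmetry of the distance, transmissions are the values of the distance operator at the
  constant function 1.\<close>

lemma transmission_friendship_graph:
  "transmission (friendship_graph n) (Inl ()) = 2 * real n"
  "i < n \<Longrightarrow> transmission (friendship_graph n) (Inr (i, b)) = 4 * real n - 2"
proof -
  have sym: "graph_dist (friendship_graph n) u v = graph_dist (friendship_graph n) v u"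
    if "u \<in> pverts (friendship_graph n)" "v \<in> pverts (friendship_graph n)" for u v
    using that by (auto simp: pverts_friendship_graph graph_dist_friendship_graph)
  have row_sum: "transmission (friendship_graph n) v =
      (\<Sum>u\<in>pverts (friendship_graph n). graph_dist (friendship_graph n) v u * 1)"
    if "v \<in> pverts (friendship_graph n)" for v
    unfolding transmission_def using that by (auto intro!: sum.cong sym)
  from row_sum[of "Inl ()"] show "transmission (friendship_graph n) (Inl ()) = 2 * real n"
    unfolding distance_operator_centre by (simp add: pverts_friendship_graph)
  from row_sum[of "Inr (i, b)"]
  show "transmission (friendship_graph n) (Inr (i, b)) = 4 * real n - 2" if "i < n"
    unfolding distance_operator_rim[OF that] using that by (simp add: pverts_friendship_graph)
qed

section \<open>Spectra from eigenbases\<close>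

lemma proots_char_poly_mat_diag:
  fixes f :: "nat \<Rightarrow> 'a :: field"
  shows "proots (char_poly (mat_diag N f)) = image_mset f (mset [0..<N])"
proof -
  have "upper_triangular (mat_diag N f)"
    by (auto simp: mat_diag_def)
  then have "char_poly (mat_diag N f) = (\<Prod>a\<leftarrow>diag_mat (mat_diag N f). [:- a, 1:])"
    by (rule char_poly_upper_triangular[OF mat_diag_dim])
  also have "diag_mat (mat_diag N f) = map f [0..<N]"
    by (auto simp: diag_mat_def mat_diag_def)
  also have "proots (\<Prod>a\<leftarrow>xs. [:- a, 1:]) = mset xs" for xs :: "'a list"
  proof (induction xs)
    case (Cons a xs)
    have "(\<Prod>a\<leftarrow>xs. [:- a, 1:]) \<noteq> 0"
      by (induction xs) (simp_all del: mult_pCons_left)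
    with Cons show ?case
      by (simp add: proots_mult del: mult_pCons_left)
  qed simp
  finally show ?thesis
    by simp
qed

text \<open>Only \<open>det P \<noteq> 0\<close> is asked for, so that an eigenbasis can be certified without its inverse.\<close>

lemma char_poly_eq_if_intertwined:
  fixes A :: "'a :: field mat"
  assumes A: "A \<in> carrier_mat N N" and D: "D \<in> carrier_mat N N" and P: "P \<in> carrier_mat N N"
    and AP: "A * P = P * D" and "det P \<noteq> 0"
  shows "char_poly A = char_poly D"
proof -
  from det_non_zero_imp_unit[OF P \<open>det P \<noteq> 0\<close>]
  obtain Q where Q: "Q \<in> carrier_mat N N" "Q * P = 1\<^sub>m N" "P * Q = 1\<^sub>m N"
    by (auto simp: Units_def ring_mat_def)
  have "A = A * (P * Q)"
    using A Q by simp
  also have "\<dots> = P * D * Q"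
    using assoc_mult_mat[OF A P Q(1)] AP by simp
  finally have "similar_mat_wit A D P Q"
    using A D P Q by (auto simp: similar_mat_wit_def Let_def)
  then have "similar_mat A D"
    by (auto simp: similar_mat_def)
  then show ?thesis
    by (rule char_poly_similar)
qed

text \<open>\<open>E b\<close> is the eigenvector with index \<open>b\<close>, and \<open>ev b\<close> is its eigenvalue. With the eigenvectors as
  columns of \<open>P\<close>, the equations say \<open>A * P = P * D\<close> with \<open>D\<close> diagonal, and independence says that
  \<open>P\<close> has trivial kernel, hence nonzero determinant. Since the index set of the basis is that of the
  matrix, the diagonal of \<open>D\<close> lists the values of \<open>ev\<close> in the order of \<open>vs\<close>, and the multiset
  forgets this order.\<close>

lemma eigenvalue_mset_eigenbasis:
  fixes K E :: "'v \<Rightarrow> 'v \<Rightarrow> 'a :: field"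
  assumes vs: "distinct vs"
    and eigen: "\<And>b v. b \<in> set vs \<Longrightarrow> v \<in> set vs \<Longrightarrow> (\<Sum>u\<in>set vs. K v u * E b u) = ev b * E b v"
    and indep: "\<And>c b. (\<And>v. v \<in> set vs \<Longrightarrow> (\<Sum>b\<in>set vs. c b * E b v) = 0) \<Longrightarrow> b \<in> set vs \<Longrightarrow> c b = 0"
  shows "eigenvalue_mset (mat (length vs) (length vs) (\<lambda>(i, j). K (vs ! i) (vs ! j))) =
    image_mset ev (mset vs)"
proof -
  define N where "N = length vs"
  define A where "A = mat N N (\<lambda>(i, j). K (vs ! i) (vs ! j))"
  define P where "P = mat N N (\<lambda>(i, j). E (vs ! j) (vs ! i))"
  define D where "D = mat_diag N (\<lambda>i. ev (vs ! i))"
  have carrier: "A \<in> carrier_mat N N" "P \<in> carrier_mat N N" "D \<in> carrier_mat N N"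
    by (auto simp: A_def P_def D_def)
  have sum_nth: "(\<Sum>k = 0..<N. f (vs ! k)) = (\<Sum>u\<in>set vs. f u)" for f :: "'v \<Rightarrow> 'a"
    using sum.reindex_bij_betw[OF bij_betw_nth[OF vs, of "{0..<N}" "set vs"], of f]
    by (simp add: N_def atLeast0LessThan)
  have "A * P = P * D"
  proof (rule eq_matI)
    fix i j
    assume "i < dim_row (P * D)" "j < dim_col (P * D)"
    then have ij: "i < N" "j < N"
      using carrier by auto
    then have "(A * P) $$ (i, j) = (\<Sum>k = 0..<N. K (vs ! i) (vs ! k) * E (vs ! j) (vs ! k))"
      by (simp add: A_def P_def scalar_prod_def)
    also have "\<dots> = ev (vs ! j) * E (vs ! j) (vs ! i)"
      using ij by (subst sum_nth, subst eigen) (auto simp: N_def)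
    also have "\<dots> = (P * D) $$ (i, j)"
      unfolding D_def mat_diag_mult_right[OF carrier(2)] using ij by (simp add: P_def)
    finally show "(A * P) $$ (i, j) = (P * D) $$ (i, j)" .
  qed (use carrier in auto)
  moreover have "det P \<noteq> 0"
  proof
    assume "det P = 0"
    then obtain x where x: "x \<in> carrier_vec N" "x \<noteq> 0\<^sub>v N" "P *\<^sub>v x = 0\<^sub>v N"
      using det_0_iff_vec_prod_zero[OF carrier(2)] by auto
    \<comment> \<open>Turn the kernel vector, indexed by positions, into coefficients indexed by \<open>set vs\<close>.\<close>
    define c where "c b = x $ (THE k. k < N \<and> vs ! k = b)" for b
    have c_nth: "c (vs ! k) = x $ k" if "k < N" for k
    proof -
      have "(THE k'. k' < N \<and> vs ! k' = vs ! k) = k"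
        using that vs by (intro the_equality) (auto simp: N_def nth_eq_iff_index_eq)
      then show ?thesis
        by (simp add: c_def)
    qed
    have "(\<Sum>b\<in>set vs. c b * E b v) = 0" if "v \<in> set vs" for v
    proof -
      from that obtain i where i: "i < N" "v = vs ! i"
        by (auto simp: in_set_conv_nth N_def)
      have "(\<Sum>b\<in>set vs. c b * E b v) = (\<Sum>k = 0..<N. x $ k * E (vs ! k) v)"
        by (subst sum_nth[symmetric]) (simp add: c_nth)
      also have "\<dots> = (P *\<^sub>v x) $ i"
        using i x(1) by (simp add: P_def scalar_prod_def mult.commute)
      finally show ?thesis
        using i x(3) by simp
    qed
    then have "x $ k = 0" if "k < N" for k
      using indep[of c "vs ! k"] that c_nth[OF that] by (simp add: N_def)
    then have "x = 0\<^sub>v N"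
      using x(1) by auto
    with x(2) show False
      by contradiction
  qed
  ultimately have "proots (char_poly A) = image_mset (\<lambda>i. ev (vs ! i)) (mset [0..<N])"
    using char_poly_eq_if_intertwined[OF carrier(1,3,2)]
    by (simp add: D_def proots_char_poly_mat_diag del: mset_upt)
  also have "\<dots> = image_mset ev (mset (map ((!) vs) [0..<N]))"
    by (simp add: image_mset.compositionality comp_def del: mset_upt flip: mset_map)
  finally show ?thesis
    by (simp add: N_def map_nth eigenvalue_mset_def A_def)
qed

lemma gen_distance_spectrum_eigenbasis:
  assumes "distinct vs" and "set vs = pverts G"
    and eigen: "\<And>b v. b \<in> pverts G \<Longrightarrow> v \<in> pverts G \<Longrightarrow>
      \<alpha> * transmission G v * E b v + (1 - \<alpha>) * (\<Sum>u\<in>pverts G. graph_dist G v u * E b u)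
      = ev b * E b v"
    and indep: "\<And>c b. (\<And>v. v \<in> pverts G \<Longrightarrow> (\<Sum>b\<in>pverts G. c b * E b v) = 0) \<Longrightarrow>
      b \<in> pverts G \<Longrightarrow> c b = 0"
  shows "gen_distance_spectrum \<alpha> G vs = image_mset ev (mset_set (pverts G))"
proof -
  define K where "K v u = (if v = u then \<alpha> * transmission G v else 0) + (1 - \<alpha>) * graph_dist G v u"
    for u v
  have fin: "finite (pverts G)"
    using assms(2) by (metis List.finite_set)
  have "gen_distance_matrix \<alpha> G vs =
      mat (length vs) (length vs) (\<lambda>(i, j). K (vs ! i) (vs ! j))"
    using assms(1)
    by (intro eq_matI) (auto simp: gen_distance_matrix_def transmission_matrix_def
        distance_matrix_def mat_diag_def K_def nth_eq_iff_index_eq)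
  moreover have "(\<Sum>u\<in>pverts G. K v u * E b u) = ev b * E b v"
    if "b \<in> pverts G" "v \<in> pverts G" for b v
  proof -
    have "(\<Sum>u\<in>pverts G. K v u * E b u) =
        (\<Sum>u\<in>pverts G. if v = u then \<alpha> * transmission G v * E b v else 0)
        + (\<Sum>u\<in>pverts G. (1 - \<alpha>) * (graph_dist G v u * E b u))"
      by (subst sum.distrib[symmetric], rule sum.cong) (auto simp: K_def algebra_simps)
    also have "\<dots> = ev b * E b v"
      using eigen[OF that] that fin by (simp flip: sum_distrib_left)
    finally show ?thesis .
  qed
  ultimately show ?thesis
    using assms(1,2) indep eigenvalue_mset_eigenbasis[of vs K E ev]
    by (simp add: gen_distance_spectrum_def mset_set_set[symmetric])
qed

section \<open>An eigenbasis for the friendship graph\<close>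

text \<open>A radial function is invariant under all symmetries of the graph: it has one value at the centre
  and another on the rim.\<close>

definition radial :: "real \<Rightarrow> real \<Rightarrow> unit + nat \<times> bool \<Rightarrow> real" where
  "radial x y v = (case v of Inl _ \<Rightarrow> x | Inr _ \<Rightarrow> y)"

text \<open>The \<open>2n + 1\<close> eigenvectors are labelled by the vertices: \<open>Inr (i, True)\<close> labels the function that is
  antisymmetric on the pair \<open>i\<close>, and for \<open>i \<noteq> 0\<close> the vertex \<open>Inr (i, False)\<close> labels the difference of
  the indicators of the pairs \<open>i\<close> and 0. This leaves the labels \<open>Inl ()\<close> and \<open>Inr (0, False)\<close> for the two
  radial eigenvectors. Their eigenvalues \<open>l\<close> and \<open>l'\<close> are parameters, later the roots of the
  characteristic polynomial of the quotient matrix.\<close>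

fun friendship_eigenvalue ::
  "nat \<Rightarrow> real \<Rightarrow> real \<Rightarrow> real \<Rightarrow> unit + nat \<times> bool \<Rightarrow> real" where
  "friendship_eigenvalue n \<alpha> l l' (Inl _) = l"
| "friendship_eigenvalue n \<alpha> l l' (Inr (i, True)) = (4 * real n - 1) * \<alpha> - 1"
| "friendship_eigenvalue n \<alpha> l l' (Inr (i, False)) =
     (if i = 0 then l' else (4 * real n + 1) * \<alpha> - 3)"

fun friendship_eigenvector ::
  "nat \<Rightarrow> real \<Rightarrow> real \<Rightarrow> real \<Rightarrow> unit + nat \<times> bool \<Rightarrow> unit + nat \<times> bool \<Rightarrow> real" where
  "friendship_eigenvector n \<alpha> l l' (Inl _) =
     radial (2 * real n * (1 - \<alpha>)) (l - 2 * real n * \<alpha>)"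
| "friendship_eigenvector n \<alpha> l l' (Inr (i, True)) =
     (\<lambda>v. of_bool (v = Inr (i, True)) - of_bool (v = Inr (i, False)))"
| "friendship_eigenvector n \<alpha> l l' (Inr (i, False)) =
     (if i = 0 then radial (2 * real n * (1 - \<alpha>)) (l' - 2 * real n * \<alpha>)
      else (\<lambda>v. case v of Inl _ \<Rightarrow> 0 | Inr (j, _) \<Rightarrow> of_bool (j = i) - of_bool (j = 0)))"

text \<open>The hypothesis on \<open>l\<close> is the characteristic equation of the quotient matrix. The equation at the
  centre holds for every \<open>l\<close>, by the choice of the two values of the function; the equation on the
  rim is the characteristic equation.\<close>

lemma radial_eigenvector:
  fixes n :: nat and \<alpha> l :: real
  defines "F \<equiv> radial (2 * real n * (1 - \<alpha>)) (l - 2 * real n * \<alpha>)"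
  assumes l: "l\<^sup>2 - ((2 * real n + 1) * \<alpha> + 4 * real n - 3) * l
      + 2 * real n * (4 * real n * \<alpha> - \<alpha> - 1) = 0"
    and v: "v \<in> pverts (friendship_graph n)"
  shows "\<alpha> * transmission (friendship_graph n) v * F v
      + (1 - \<alpha>) * (\<Sum>u\<in>pverts (friendship_graph n). graph_dist (friendship_graph n) v u * F u)
      = l * F v"
proof -
  consider "v = Inl ()" | i b where "v = Inr (i, b)" "i < n"
    using v by (auto simp: pverts_friendship_graph)
  then show ?thesis
  proof cases
    case 1
    then show ?thesis
      by (simp add: transmission_friendship_graph distance_operator_centre F_def radial_def
          algebra_simps)
  next
    case (2 i b)
    define a where "a = l - 2 * real n * \<alpha>"
    have F: "F (Inl x) = 2 * real n * (1 - \<alpha>)" "F (Inr y) = a" for x y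
      by (simp_all add: F_def radial_def a_def)
    have "\<alpha> * (4 * real n - 2) * a
        + (1 - \<alpha>) * (2 * real n * (1 - \<alpha>) + 2 * (\<Sum>i<n. a + a) - (a + a) - a) - l * a
      = - (l\<^sup>2 - ((2 * real n + 1) * \<alpha> + 4 * real n - 3) * l
          + 2 * real n * (4 * real n * \<alpha> - \<alpha> - 1))"
      by (simp add: a_def algebra_simps power2_eq_square)
    then have "\<alpha> * (4 * real n - 2) * a
        + (1 - \<alpha>) * (2 * real n * (1 - \<alpha>) + 2 * (\<Sum>i<n. a + a) - (a + a) - a) = l * a"
      using l by linarith
    then show ?thesis
      unfolding 2(1) transmission_friendship_graph(2)[OF 2(2)] distance_operator_rim[OF 2(2)] F .
  qed
qed

lemma friendship_eigenvector_eigen: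
  fixes n :: nat and \<alpha> l l' :: real
  assumes l: "l\<^sup>2 - ((2 * real n + 1) * \<alpha> + 4 * real n - 3) * l
      + 2 * real n * (4 * real n * \<alpha> - \<alpha> - 1) = 0"
    and l': "l'\<^sup>2 - ((2 * real n + 1) * \<alpha> + 4 * real n - 3) * l'
      + 2 * real n * (4 * real n * \<alpha> - \<alpha> - 1) = 0"
    and b: "b \<in> pverts (friendship_graph n)" and v: "v \<in> pverts (friendship_graph n)"
  defines "E \<equiv> friendship_eigenvector n \<alpha> l l' b"
  shows "\<alpha> * transmission (friendship_graph n) v * E v
      + (1 - \<alpha>) * (\<Sum>u\<in>pverts (friendship_graph n). graph_dist (friendship_graph n) v u * E u)
      = friendship_eigenvalue n \<alpha> l l' b * E v"
proof -
  consider "b = Inl ()" | "b = Inr (0, False)" | i where "b = Inr (i, True)" "i < n"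
    | i where "b = Inr (i, False)" "i < n" "i \<noteq> 0"
    using b by (auto simp: pverts_friendship_graph)
  then show ?thesis
  proof cases
    case 1
    then show ?thesis
      using radial_eigenvector[OF l v] by (simp add: E_def)
  next
    case 2
    then show ?thesis
      using radial_eigenvector[OF l' v] by (simp add: E_def)
  next
    case (3 i)
    have pair: "E (Inr (j, True)) + E (Inr (j, False)) = 0" for j
      using 3 by (simp add: E_def)
    consider "v = Inl ()" | j c where "v = Inr (j, c)" "j < n"
      using v by (auto simp: pverts_friendship_graph)
    then show ?thesis
    proof cases
      case 1
      then show ?thesis
        using 3 pair by (simp add: transmission_friendship_graph distance_operator_centre)
          (simp add: E_def)
    next
      case (2 j c)
      have "E (Inl ()) = 0"
        using 3 by (simp add: E_def)
      then have "(\<Sum>u\<in>pverts (friendship_graph n).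
          graph_dist (friendship_graph n) (Inr (j, c)) u * E u) = - E (Inr (j, c))"
        using 2(2) pair \<open>E (Inl ()) = 0\<close> by (simp add: distance_operator_rim)
      then show ?thesis
        using 2 3 by (simp add: transmission_friendship_graph) (simp add: algebra_simps)
    qed
  next
    case (4 i)
    have E: "E (Inr (j, c)) = of_bool (j = i) - of_bool (j = 0)" "E (Inl ()) = 0" for j c
      using 4 by (simp_all add: E_def)
    have sum0: "(\<Sum>j<n. E (Inr (j, True)) + E (Inr (j, False))) = 0"
      using 4 by (simp add: E sum.distrib sum_subtractf)
    consider "v = Inl ()" | j c where "v = Inr (j, c)" "j < n"
      using v by (auto simp: pverts_friendship_graph)
    then show ?thesis
    proof cases
      case 1
      then show ?thesis
        using 4 sum0 by (simp add: transmission_friendship_graph distance_operator_centre E)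
    next
      case (2 j c)
      have "(\<Sum>u\<in>pverts (friendship_graph n).
          graph_dist (friendship_graph n) (Inr (j, c)) u * E u) = - 3 * E (Inr (j, c))"
        unfolding distance_operator_rim[OF 2(2)] sum0 by (simp add: E)
      then show ?thesis
        using 2 4 by (simp add: transmission_friendship_graph) (simp add: algebra_simps)
    qed
  qed
qed

text \<open>The equations at the two vertices of a pair differ only in the sign of the antisymmetric
  coefficient, which is therefore 0. Let \<open>k\<close> be what the radial vectors contribute on the rim.
  The remaining equation at the pair \<open>j \<noteq> 0\<close> makes its coefficient \<open>- k\<close>, and the one at the pair 0 then
  says \<open>k + (n - 1) k = 0\<close>. So \<open>k = 0\<close>, and only a combination of the two radial vectors is left.
  Their common value at the centre is nonzero because \<open>\<alpha> \<noteq> 1\<close>, and their values on the rim differ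
  because \<open>l \<noteq> l'\<close>.\<close>

lemma friendship_eigenvector_indep:
  fixes n :: nat and \<alpha> l l' :: real
  assumes "n \<ge> 1" and "\<alpha> \<noteq> 1" and "l \<noteq> l'"
    and comb: "\<And>v. v \<in> pverts (friendship_graph n) \<Longrightarrow>
      (\<Sum>b\<in>pverts (friendship_graph n). c b * friendship_eigenvector n \<alpha> l l' b v) = 0"
    and b: "b \<in> pverts (friendship_graph n)"
  shows "c b = 0"
proof -
  let ?s = "\<lambda>i. c (Inr (i, False))"
  define k where "k = c (Inl ()) * (l - 2 * real n * \<alpha>) + ?s 0 * (l' - 2 * real n * \<alpha>)"
  have split0: "(\<Sum>i<n. f i) = f 0 + (\<Sum>i=1..<n. f i)" for f :: "nat \<Rightarrow> real"
    using \<open>n \<ge> 1\<close> by (simp add: atLeast0LessThan[symmetric] sum.atLeast_Suc_lessThan)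
  have rim: "k + (\<Sum>i=1..<n. ?s i * (of_bool (j = i) - of_bool (j = 0)))
      + (if a then c (Inr (j, True)) else - c (Inr (j, True))) = 0"
    if "j < n" for j a
  proof -
    let ?E = "friendship_eigenvector n \<alpha> l l'"
    have "(\<Sum>i<n. c (Inr (i, True)) * ?E (Inr (i, True)) (Inr (j, a))) =
        (\<Sum>i<n. if i = j then if a then c (Inr (j, True)) else - c (Inr (j, True)) else 0)"
      by (rule sum.cong) auto
    moreover have "(\<Sum>i<n. ?s i * ?E (Inr (i, False)) (Inr (j, a))) =
        ?s 0 * (l' - 2 * real n * \<alpha>) + (\<Sum>i=1..<n. ?s i * (of_bool (j = i) - of_bool (j = 0)))"
      by (subst split0) (auto simp: radial_def intro!: sum.cong)
    ultimately show ?thesis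
      using comb[of "Inr (j, a)"] that
      by (simp add: pverts_friendship_graph k_def radial_def
          sum_friendship_graph[unfolded pverts_friendship_graph] sum.distrib)
  qed
  have asym: "c (Inr (j, True)) = 0" if "j < n" for j
    using rim[OF that, of True] rim[OF that, of False] by simp
  have sym: "?s j = - k" if "j < n" "j \<noteq> 0" for j
  proof -
    have "(\<Sum>i=1..<n. ?s i * (of_bool (j = i) - of_bool (j = 0)))
        = (\<Sum>i=1..<n. if i = j then ?s j else 0)"
      using that by (intro sum.cong) auto
    then show ?thesis
      using rim[OF that(1), of True] asym[OF that(1)] that by simp
  qed
  have "k = (\<Sum>i=1..<n. ?s i)"
    using rim[of 0 True] asym[of 0] \<open>n \<ge> 1\<close> by (simp add: sum_negf)
  also have "\<dots> = - (real n - 1) * k"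
    using \<open>n \<ge> 1\<close> by (simp add: sym of_nat_diff algebra_simps)
  finally have "real n * k = 0"
    by (simp add: algebra_simps)
  then have "k = 0"
    using \<open>n \<ge> 1\<close> by simp
  have "(\<Sum>i<n. ?s i * friendship_eigenvector n \<alpha> l l' (Inr (i, False)) (Inl ()))
      = ?s 0 * (2 * real n * (1 - \<alpha>))"
    by (subst split0) (simp add: radial_def)
  then have "(c (Inl ()) + ?s 0) * (2 * real n * (1 - \<alpha>)) = 0"
    using comb[of "Inl ()"]
    by (simp add: pverts_friendship_graph radial_def
        sum_friendship_graph[unfolded pverts_friendship_graph] algebra_simps)
  then have centre: "c (Inl ()) = - ?s 0"
    using \<open>n \<ge> 1\<close> \<open>\<alpha> \<noteq> 1\<close> by simp
  then have "?s 0 * (l' - l) = 0"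
    using \<open>k = 0\<close> by (simp add: k_def algebra_simps)
  then have "?s 0 = 0"
    using \<open>l \<noteq> l'\<close> by simp
  consider "b = Inl ()" | "b = Inr (0, False)" | i where "b = Inr (i, True)" "i < n"
    | i where "b = Inr (i, False)" "i < n" "i \<noteq> 0"
    using b by (auto simp: pverts_friendship_graph)
  then show ?thesis
    using centre \<open>?s 0 = 0\<close> \<open>k = 0\<close> asym sym by cases simp_all
qed

lemma image_mset_friendship_eigenvalue:
  assumes "n \<ge> 1"
  shows "image_mset (friendship_eigenvalue n \<alpha> l l') (mset_set (pverts (friendship_graph n))) =
    replicate_mset (n - 1) ((4 * real n + 1) * \<alpha> - 3)
    + replicate_mset n ((4 * real n - 1) * \<alpha> - 1) + {#l, l'#}"
proof -
  let ?T = "(\<lambda>i. Inr (i, True)) ` {..<n} :: (unit + nat \<times> bool) set"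
  let ?F = "(\<lambda>i. Inr (i, False)) ` {1..<n} :: (unit + nat \<times> bool) set"
  let ?ev = "friendship_eigenvalue n \<alpha> l l'"
  have "pverts (friendship_graph n) = insert (Inl ()) (insert (Inr (0, False)) (?T \<union> ?F))"
  proof -
    have "Inr (i, b) \<in> insert (Inr (0, False)) (?T \<union> ?F)" if "i < n" for i b
      using that by (cases b; cases "i = 0") auto
    then show ?thesis
      using assms by (auto simp: pverts_friendship_graph)
  qed
  moreover have "mset_set (?T \<union> ?F) = mset_set ?T + mset_set ?F"
    by (rule mset_set_Union) auto
  moreover have "image_mset ?ev (mset_set ?T) = replicate_mset n ((4 * real n - 1) * \<alpha> - 1)"
    by (simp add: image_mset_mset_set[symmetric] inj_on_def image_mset.compositionality comp_def
        image_mset_const_eq)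
  moreover have "image_mset ?ev (mset_set ?F) = replicate_mset (n - 1) ((4 * real n + 1) * \<alpha> - 3)"
  proof -
    have "image_mset ?ev (mset_set ?F)
        = image_mset (\<lambda>i. (4 * real n + 1) * \<alpha> - 3) (mset_set {1..<n})"
      by (subst image_mset_mset_set[symmetric])
        (auto simp: inj_on_def image_mset.compositionality intro!: image_mset_cong)
    then show ?thesis
      by (simp add: image_mset_const_eq)
  qed
  ultimately show ?thesis
    by (simp add: image_iff)
qed

theorem theorem4p1:
  fixes n :: nat and \<alpha> :: real and vs :: "(unit + nat \<times> bool) list"
    and lplus lminus :: real
  assumes "n \<ge> 1" and "0 \<le> \<alpha>" and "\<alpha> \<le> 1"
    and "distinct vs" and "set vs = pverts (friendship_graph n)"
    and "lplus = ((2 * real n + 1) * \<alpha> + 4 * real n - 3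
           + sqrt (((2 * real n + 1) * \<alpha> + 4 * real n - 3)\<^sup>2
                   - 8 * real n * (4 * real n * \<alpha> - \<alpha> - 1))) / 2"
    and "lminus = ((2 * real n + 1) * \<alpha> + 4 * real n - 3
           - sqrt (((2 * real n + 1) * \<alpha> + 4 * real n - 3)\<^sup>2
                   - 8 * real n * (4 * real n * \<alpha> - \<alpha> - 1))) / 2"
  shows "gen_distance_spectrum \<alpha> (friendship_graph n) vs =
           replicate_mset (n - 1) ((4 * real n + 1) * \<alpha> - 3)
         + replicate_mset n ((4 * real n - 1) * \<alpha> - 1)
         + {#lplus, lminus#}"
proof -
  define t where "t = (2 * real n + 1) * \<alpha> + 4 * real n - 3"
  define d where "d = 2 * real n * (4 * real n * \<alpha> - \<alpha> - 1)"
  \<comment> \<open>The terms on the right are the squared difference of the diagonal entries of the quotient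
    matrix and four times the product of its off-diagonal entries. The latter is positive for
    \<open>\<alpha> \<noteq> 1\<close>, so that the two radial eigenvalues are then real and distinct.\<close>
  have disc: "t\<^sup>2 - 4 * d = ((2 * real n - 1) * \<alpha> - (4 * real n - 3))\<^sup>2 + 8 * real n * (1 - \<alpha>)\<^sup>2"
    by (simp add: t_def d_def algebra_simps power2_eq_square)
  have lplus: "lplus = (t + sqrt (t\<^sup>2 - 4 * d)) / 2" and lminus: "lminus = (t - sqrt (t\<^sup>2 - 4 * d)) / 2"
    using assms(6,7) by (simp_all add: t_def d_def)
  let ?ev = "friendship_eigenvalue n \<alpha> lminus lplus"
  have "gen_distance_spectrum \<alpha> (friendship_graph n) vs =
      image_mset ?ev (mset_set (pverts (friendship_graph n)))"
  proof (cases "\<alpha> = 1")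
    case True
    \<comment> \<open>The matrix is now the diagonal of the transmissions, and the indicator functions of the
      vertices replace the eigenbasis. The centre is labelled with \<open>lminus\<close>, which is its
      transmission \<open>2n\<close> because \<open>2n \<le> 4n - 2\<close>.\<close>
    have "sqrt (t\<^sup>2 - 4 * d) = 2 * real n - 2"
    proof -
      have "t\<^sup>2 - 4 * d = (2 * real n - 2)\<^sup>2"
        unfolding disc by (simp add: True power2_eq_square algebra_simps)
      then show ?thesis
        using \<open>n \<ge> 1\<close> by simp
    qed
    then have ends: "lplus = 4 * real n - 2" "lminus = 2 * real n"
      by (simp_all add: lplus lminus t_def True)
    have rim: "?ev (Inr (i, a)) = 4 * real n - 2" for i a
      by (cases a) (simp_all add: ends True)
    show ?thesis
    proof (rule gen_distance_spectrum_eigenbasis[OF assms(4,5), where E = "\<lambda>b v. of_bool (b = v)"])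
      fix b v
      assume "b \<in> pverts (friendship_graph n)" "v \<in> pverts (friendship_graph n)"
      then show "\<alpha> * transmission (friendship_graph n) v * of_bool (b = v)
        + (1 - \<alpha>) * (\<Sum>u\<in>pverts (friendship_graph n).
            graph_dist (friendship_graph n) v u * of_bool (b = u))
        = ?ev b * of_bool (b = v)"
        using rim by (auto simp: True ends pverts_friendship_graph transmission_friendship_graph)
    next
      fix c :: "unit + nat \<times> bool \<Rightarrow> real" and b
      assume "\<And>v. v \<in> pverts (friendship_graph n) \<Longrightarrow>
          (\<Sum>b\<in>pverts (friendship_graph n). c b * of_bool (b = v)) = 0"
        and "b \<in> pverts (friendship_graph n)"
      moreover from this(2) have "(\<Sum>b'\<in>pverts (friendship_graph n). c b' * of_bool (b' = b)) = c b"
        by (simp add: pverts_friendship_graph of_bool_def if_distrib cong: if_cong)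
      ultimately show "c b = 0"
        by simp
    qed
  next
    case False
    have pos: "t\<^sup>2 - 4 * d > 0"
      unfolding disc using \<open>n \<ge> 1\<close> False by (intro add_nonneg_pos) auto
    then have root: "lplus\<^sup>2 - t * lplus + d = 0" "lminus\<^sup>2 - t * lminus + d = 0"
      by (simp_all add: lplus lminus power2_eq_square field_simps)
    have "lminus \<noteq> lplus"
      using pos by (simp add: lplus lminus)
    show ?thesis
    proof (rule gen_distance_spectrum_eigenbasis[OF assms(4,5),
          where E = "friendship_eigenvector n \<alpha> lminus lplus"])
      fix b v
      assume bv: "b \<in> pverts (friendship_graph n)" "v \<in> pverts (friendship_graph n)"
      show "\<alpha> * transmission (friendship_graph n) v * friendship_eigenvector n \<alpha> lminus lplus b v
        + (1 - \<alpha>) * (\<Sum>u\<in>pverts (friendship_graph n).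
            graph_dist (friendship_graph n) v u * friendship_eigenvector n \<alpha> lminus lplus b u)
        = ?ev b * friendship_eigenvector n \<alpha> lminus lplus b v"
        using root bv unfolding t_def d_def by (intro friendship_eigenvector_eigen)
    qed (rule friendship_eigenvector_indep[OF \<open>n \<ge> 1\<close> False \<open>lminus \<noteq> lplus\<close>])
  qed
  then show ?thesis
    using \<open>n \<ge> 1\<close> by (simp add: image_mset_friendship_eigenvalue add_mset_commute)
qed

end
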